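(* Let $\gamma$ be a nonnegative symmetric decreasing kernel supported on $[0,1]$, and let $\gamma_{\delta_1}(s)=\frac{1}{\delta_1^3}\gamma\left(\frac{s}{\delta_1}\right)$, $\gamma_{\delta_2}(s)=\frac{1}{\delta_2^3}\gamma\left(\frac{s}{\delta_2}\right)$ with $\delta_1=M\delta_2$, where $M$ is a given positive integer. Then for every $u\in S_{\mathsf{qnl}}$, $$b_{\mathsf{qnl}}(u,u)\ \ge\ b_{\mathsf{n}}(u,u)=\|u\|_{S_{\delta_1}}^2 .$$
   Context: Setting: $a,b>0$, $\Omega=[-a,b]$, $\delta_1,\delta_2>0$, $\Omega_{\mathcal I}=\{y\in\mathbb{R}\setminus\Omega:\ |y-x|\le\delta_1\text{ for some }x\in\Omega\}$. Functions on $\Omega\cup\Omega_{\mathcal I}$ vanishing on $\Omega_{\mathcal I}$ are extended by zero to $\mathbb{R}$. The kernel $\gamma$ is a measurable function of the distance $s=|x-y|$, $\gamma\ge0$, $\gamma(s)=0$ for $s\ge1$, $\int_0^1 s^2\gamma(s)\,ds<\infty$. Quasinonlocal bilinear form: $$b_{\mathsf{qnl}}(u,v)=\int_{x,y\in\mathbb{R},\,x\le0\text{ or }y\le0}\gamma_{\delta_1}(|y-x|)(u(y)-u(x))(v(y)-v(x))\,dx\,dy$$ $$+\int_{x>0\text{ and }y>0}M\gamma_{\delta_1}(|y-x|)\sum_{j=0}^{M-1}\Big(u\big(x+\tfrac{j+1}{M}(y-x)\big)-u\big(x+\tfrac jM(y-x)\big)\Big)\Big(v\big(x+\tfrac{j+1}{M}(y-x)\big)-v\big(x+\tfrac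 jM(y-x)\big)\Big)dx\,dy.$$ $S_{\mathsf{qnl}}=\{u\in L^2(\Omega\cup\Omega_{\mathcal I}):\ b_{\mathsf{qnl}}(u,u)<\infty,\ u|_{\Omega_{\mathcal I}}=0\}$. Nonlocal bilinear form and energy norm for $\gamma_{\delta_1}$: $$b_{\mathsf n}(u,v)=\int_{\Omega\cup\Omega_{\mathcal I}}\int_{\Omega\cup\Omega_{\mathcal I}}\gamma_{\delta_1}(|y-x|)(u(y)-u(x))(v(y)-v(x))\,dy\,dx,$$ $$\|u\|_{S_{\delta_1}}^2=\int_{\Omega\cup\Omega_{\mathcal I}}\int_{\Omega\cup\Omega_{\mathcal I}}\gamma_{\delta_1}(|y-x|)(u(y)-u(x))^2\,dx\,dy.$$ *)

theory Defs
  imports "HOL-Analysis.Analysis"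
begin

definition Omega :: "real \<Rightarrow> real \<Rightarrow> real set" where
  "Omega a b = {-a..b}"

definition Omega_I :: "real \<Rightarrow> real \<Rightarrow> real \<Rightarrow> real set" where
  "Omega_I a b \<delta>\<^sub>1 = {y. y \<notin> Omega a b \<and> (\<exists>x\<in>Omega a b. \<bar>y - x\<bar> \<le> \<delta>\<^sub>1)}"

definition scaled_kernel :: "(real \<Rightarrow> real) \<Rightarrow> real \<Rightarrow> real \<Rightarrow> real" where
  "scaled_kernel \<gamma> \<delta> s = 1 / \<delta> ^ 3 * \<gamma> (s / \<delta>)"

text \<open>
  In the forms below, \<open>k\<close> is a scaled kernel, a function of the distance; it enters only
  through \<open>k \<bar>y - x\<bar>\<close>, which is the symmetry of the kernel in \<open>x\<close> and \<open>y\<close>.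
  Its value at distance 0 is irrelevant (the diagonal is a null set), so kernels that are
  singular at the origin are covered.
\<close>

definition nonlocal_integrand ::
  "(real \<Rightarrow> real) \<Rightarrow> (real \<Rightarrow> real) \<Rightarrow> (real \<Rightarrow> real) \<Rightarrow> real \<Rightarrow> real \<Rightarrow> real" where
  "nonlocal_integrand k u v x y = k \<bar>y - x\<bar> * (u y - u x) * (v y - v x)"

definition reconstructed_integrand ::
  "(real \<Rightarrow> real) \<Rightarrow> nat \<Rightarrow> (real \<Rightarrow> real) \<Rightarrow> (real \<Rightarrow> real) \<Rightarrow> real \<Rightarrow> real \<Rightarrow> real" where
  "reconstructed_integrand k M u v x y =
     real M * k \<bar>y - x\<bar> *
     (\<Sum>j<M. (u (x + real (j + 1) / real M * (y - x)) - u (x + real j / real M * (y - x))) *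
            (v (x + real (j + 1) / real M * (y - x)) - v (x + real j / real M * (y - x))))"

definition nonlocal_region :: "(real \<times> real) set" where
  "nonlocal_region = {(x, y). x \<le> 0 \<or> y \<le> 0}"

definition local_region :: "(real \<times> real) set" where
  "local_region = {(x, y). x > 0 \<and> y > 0}"

definition b_qnl ::
  "(real \<Rightarrow> real) \<Rightarrow> nat \<Rightarrow> (real \<Rightarrow> real) \<Rightarrow> (real \<Rightarrow> real) \<Rightarrow> real" where
  "b_qnl k M u v =
     (LINT p:nonlocal_region|lebesgue. nonlocal_integrand k u v (fst p) (snd p)) +
     (LINT p:local_region|lebesgue. reconstructed_integrand k M u v (fst p) (snd p))"

text \<open>
  Finiteness of the energy \<open>b_qnl k M u u\<close>. The Bochner integral is total, so finiteness has to
  be stated as integrability; both integrands are nonnegative when \<open>u = v\<close>, so this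
  is finiteness of the sum of the two integrals.
\<close>

definition finite_qnl_energy :: "(real \<Rightarrow> real) \<Rightarrow> nat \<Rightarrow> (real \<Rightarrow> real) \<Rightarrow> bool" where
  "finite_qnl_energy k M u \<longleftrightarrow>
     set_integrable lebesgue nonlocal_region (\<lambda>p. nonlocal_integrand k u u (fst p) (snd p)) \<and>
     set_integrable lebesgue local_region (\<lambda>p. reconstructed_integrand k M u u (fst p) (snd p))"

definition square_integrable_on :: "real set \<Rightarrow> (real \<Rightarrow> real) \<Rightarrow> bool" where
  "square_integrable_on A u \<longleftrightarrow>
     set_borel_measurable lebesgue A u \<and> set_integrable lebesgue A (\<lambda>x. (u x)\<^sup>2)"

text \<open>
  An element of \<open>S_qnl\<close> is a representative of its \<open>L\<^sup>2\<close> class, already extended by zero to the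
  real line; hence it vanishes almost everywhere on \<open>Omega_I\<close> and everywhere outside
  \<open>Omega \<union> Omega_I\<close>.
\<close>

definition S_qnl ::
  "real \<Rightarrow> real \<Rightarrow> real \<Rightarrow> (real \<Rightarrow> real) \<Rightarrow> nat \<Rightarrow> (real \<Rightarrow> real) set" where
  "S_qnl a b \<delta>\<^sub>1 k M =
     {u. square_integrable_on (Omega a b \<union> Omega_I a b \<delta>\<^sub>1) u \<and>
         finite_qnl_energy k M u \<and>
         (AE x in lebesgue. x \<in> Omega_I a b \<delta>\<^sub>1 \<longrightarrow> u x = 0) \<and>
         (\<forall>x. x \<notin> Omega a b \<union> Omega_I a b \<delta>\<^sub>1 \<longrightarrow> u x = 0)}"

definition b_n ::
  "real \<Rightarrow> real \<Rightarrow> real \<Rightarrow> (real \<Rightarrow> real) \<Rightarrow> (real \<Rightarrow> real) \<Rightarrow> (real \<Rightarrow> real) \<Rightarrow> real" where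
  "b_n a b \<delta>\<^sub>1 k u v =
     (LINT x:Omega a b \<union> Omega_I a b \<delta>\<^sub>1|lebesgue.
        LINT y:Omega a b \<union> Omega_I a b \<delta>\<^sub>1|lebesgue. nonlocal_integrand k u v x y)"

definition norm_S ::
  "real \<Rightarrow> real \<Rightarrow> real \<Rightarrow> (real \<Rightarrow> real) \<Rightarrow> (real \<Rightarrow> real) \<Rightarrow> real" where
  "norm_S a b \<delta>\<^sub>1 k u =
     sqrt (LINT y:Omega a b \<union> Omega_I a b \<delta>\<^sub>1|lebesgue.
             LINT x:Omega a b \<union> Omega_I a b \<delta>\<^sub>1|lebesgue. k \<bar>y - x\<bar> * (u y - u x)\<^sup>2)"

end

(*
  The increment of u over [x, y] is the sum of its M increments over the equal subintervals, so
  by the Cauchy-Schwarz inequality (u y - u x)^2 is at most M times the sum of their squares.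
  Hence the reconstructed integrand dominates the nonlocal one pointwise, and b_qnl(u, u) bounds
  the integral of the nonlocal integrand over the whole plane. The remaining work is
  measurability and the Fubini theorem with respect to the completed Lebesgue measure, for
  which u is replaced by a Borel function that equals u almost everywhere.
*)

theory Submission
  imports Defs
begin

text \<open>Completeness of Lebesgue measure: what \<open>f\<close> does on the exceptional null set
  cannot spoil measurability, so a Borel representative \<open>g\<close> may stand in for
  \<open>f\<close>.\<close>

lemma AE_eq_borel_measurable_lebesgue:
  fixes f g :: "'a::euclidean_space \<Rightarrow> 'b::euclidean_space"
  assumes g: "g \<in> borel_measurable lborel" and ae: "AE x in lborel. f x = g x"
  shows "f \<in> borel_measurable lebesgue"
  by (rule borel_measurable_AE[OF measurable_completion[OF g]])
    (use ae in \<open>auto intro: AE_completion simp: eq_commute\<close>)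

lemma AE_eq_integral_lebesgue:
  fixes f g :: "'a::euclidean_space \<Rightarrow> 'b::euclidean_space"
  assumes g: "g \<in> borel_measurable lborel" and ae: "AE x in lborel. f x = g x"
  shows "integral\<^sup>L lebesgue f = integral\<^sup>L lborel g"
  using integral_cong_AE[OF AE_eq_borel_measurable_lebesgue[OF assms] measurable_completion[OF g]]
    AE_completion[OF ae] integral_completion[OF g] by simp

text \<open>Lebesgue measure on the product is the completion of the product measure, so Fubini is
  applied to a Borel representative \<open>g\<close>. For almost every \<open>x\<close> the sections
  of \<open>f\<close> and \<open>g\<close> agree almost everywhere; hence the inner integrals agree
  for almost every \<open>x\<close>, and those of \<open>g\<close> are Borel in
  \<open>x\<close>.\<close>

lemma integral_lebesgue_prod:
  fixes f :: "'a::euclidean_space \<times> 'b::euclidean_space \<Rightarrow> real"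
  assumes f: "integrable lebesgue f"
  shows "(LINT x|lebesgue. LINT y|lebesgue. f (x, y)) = (LINT p|lebesgue. f p)"
proof -
  obtain g where g: "g \<in> borel_measurable lborel" and ae: "AE p in lborel. f p = g p"
    using completion_ex_borel_measurable_real[OF borel_measurable_integrable[OF f]] by blast
  have "integrable lebesgue g"
    using f by (rule integrable_cong_AE_imp) (use g ae in \<open>auto intro: AE_completion measurable_completion simp: eq_commute\<close>)
  then have g_int: "integrable (lborel \<Otimes>\<^sub>M lborel) g"
    by (simp add: lborel_prod integrable_completion[OF g])
  have [measurable]: "g \<in> borel_measurable (lborel \<Otimes>\<^sub>M lborel)"
    using g by (simp add: lborel_prod)
  have "AE x in lborel. AE y in lborel. f (x, y) = g (x, y)"
    by (rule lborel_pair.AE_pair) (simp only: lborel_prod ae)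
  then have "AE x in lborel. (LINT y|lebesgue. f (x, y)) = (LINT y|lborel. g (x, y))"
    by (rule eventually_mono) (rule AE_eq_integral_lebesgue, auto)
  then have "(LINT x|lebesgue. LINT y|lebesgue. f (x, y)) = (LINT x|lborel. LINT y|lborel. g (x, y))"
    by (rule AE_eq_integral_lebesgue[rotated]) measurable
  also have "\<dots> = (LINT p|lborel. g p)"
    using lborel_pair.integral_fst'[OF g_int] by (simp add: lborel_prod)
  also have "\<dots> = (LINT p|lebesgue. f p)"
    using AE_eq_integral_lebesgue[OF g ae] by simp
  finally show ?thesis .
qed

text \<open>A projection pulls a null set \<open>N\<close> back to a strip
  \<open>N \<times> UNIV\<close> or \<open>UNIV \<times> N\<close>, which is again null. So
  \<open>u\<close> and its Borel representative still agree almost everywhere after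
  composition.\<close>

lemma borel_measurable_lebesgue_fst_snd:
  fixes u :: "'a::euclidean_space \<Rightarrow> real"
  assumes u: "u \<in> borel_measurable lebesgue"
  shows "(\<lambda>p::'a \<times> 'b::euclidean_space. u (fst p)) \<in> borel_measurable lebesgue"
    and "(\<lambda>p::'b \<times> 'a. u (snd p)) \<in> borel_measurable lebesgue"
proof -
  obtain v where [measurable]: "v \<in> borel_measurable lborel" and "AE x in lborel. u x = v x"
    using completion_ex_borel_measurable_real[OF u] by blast
  then obtain N where N: "{x \<in> space lborel. u x \<noteq> v x} \<subseteq> N" "N \<in> null_sets lborel"
    by (auto elim!: AE_E simp: null_sets_def)
  have "N \<times> UNIV \<in> null_sets (lborel \<Otimes>\<^sub>M (lborel :: 'b measure))"
    "UNIV \<times> N \<in> null_sets ((lborel :: 'b measure) \<Otimes>\<^sub>M lborel)"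
    using N(2) by (auto simp: null_sets_def lborel.emeasure_pair_measure_Times)
  then have "AE p::'a \<times> 'b in lborel. u (fst p) = v (fst p)"
    "AE p::'b \<times> 'a in lborel. u (snd p) = v (snd p)"
    using N(1) by (auto simp: lborel_prod intro!: AE_I'[of "N \<times> UNIV"] AE_I'[of "UNIV \<times> N"])
  moreover have "(\<lambda>p::'a \<times> 'b. v (fst p)) \<in> borel_measurable lborel"
    "(\<lambda>p::'b \<times> 'a. v (snd p)) \<in> borel_measurable lborel"
    by (simp_all flip: lborel_prod)
  ultimately show "(\<lambda>p::'a \<times> 'b. u (fst p)) \<in> borel_measurable lebesgue"
    "(\<lambda>p::'b \<times> 'a. u (snd p)) \<in> borel_measurable lebesgue"
    by (auto intro: AE_eq_borel_measurable_lebesgue)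
qed

lemma nonlocal_integrand_measurable:
  assumes k: "antimono_on {0<..} k" and u: "u \<in> borel_measurable lebesgue"
  shows "(\<lambda>p. nonlocal_integrand k u u (fst p) (snd p)) \<in> borel_measurable lebesgue"
proof -
  \<comment> \<open>Antimonotonicity is known only on the open half-line, where it makes
    \<open>k\<close> Borel. Cutting off at 0 extends this to a Borel function on the whole line,
    ready to be composed with the distance.\<close>
  define h where "h s = (if s \<in> {0<..} then k s else 0)" for s
  have "mono_on {0<..} (\<lambda>s. - k s)"
    using k by (auto simp: monotone_on_def)
  from borel_measurable_uminus[OF borel_measurable_mono_on_fnc[OF this]]
  have [measurable]: "h \<in> borel_measurable borel"
    unfolding h_def by (subst measurable_If_restrict_space_iff) (auto simp: greaterThan_def)
  have "(\<lambda>p::real \<times> real. h \<bar>snd p - fst p\<bar>) \<in> borel_measurable lborel"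
    by (simp flip: lborel_prod)
  then have "(\<lambda>p. nonlocal_integrand h u u (fst p) (snd p)) \<in> borel_measurable lebesgue"
    unfolding nonlocal_integrand_def
    by (intro borel_measurable_times borel_measurable_diff borel_measurable_lebesgue_fst_snd
          u measurable_completion) simp
  \<comment> \<open>On the diagonal, where \<open>h\<close> and \<open>k\<close> may differ, both integrands vanish.\<close>
  moreover have "nonlocal_integrand h u u x y = nonlocal_integrand k u u x y" for x y
    by (auto simp: nonlocal_integrand_def h_def)
  ultimately show ?thesis by simp
qed

lemma nonlocal_le_reconstructed_integrand:
  assumes k: "k \<bar>y - x\<bar> \<ge> 0" and M: "M > 0"
  shows "nonlocal_integrand k u u x y \<le> reconstructed_integrand k M u u x y"
proof -
  define d where "d j = u (x + real (j + 1) / real M * (y - x)) - u (x + real j / real M * (y - x))" for j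
  have "(\<Sum>j<M. d j) = u y - u x"
    using sum_lessThan_telescope[of "\<lambda>j. u (x + real j / real M * (y - x))" M] M by (simp add: d_def)
  \<comment> \<open>The second vector in Cauchy-Schwarz is constantly 1 and has squared norm
    \<open>M\<close>; this is the weight \<open>M\<close> in the reconstructed integrand.\<close>
  then have "(u y - u x)\<^sup>2 \<le> real M * (\<Sum>j<M. (d j)\<^sup>2)"
    using Cauchy_Schwarz_ineq_sum[of "\<lambda>_. 1" d "{..<M}"] by simp
  from mult_left_mono[OF this k] show ?thesis
    by (simp add: nonlocal_integrand_def reconstructed_integrand_def d_def power2_eq_square mult_ac)
qed

lemma Omega_Un_Omega_I_borel:
  assumes "a + b \<ge> 0" and "\<delta> \<ge> 0"
  shows "Omega a b \<union> Omega_I a b \<delta> \<in> sets borel"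
proof -
  have "Omega a b \<union> Omega_I a b \<delta> = {-a - \<delta>..b + \<delta>}"
  proof (rule set_eqI)
    fix y
    have "\<exists>x\<in>{-a..b}. \<bar>y - x\<bar> \<le> \<delta>" if "-a - \<delta> \<le> y" "y \<le> b + \<delta>"
      \<comment> \<open>The witness is the point of \<open>{-a..b}\<close> nearest to
        \<open>y\<close>.\<close>
      using that assms by (intro bexI[of _ "max (-a) (min b y)"]) auto
    then show "y \<in> Omega a b \<union> Omega_I a b \<delta> \<longleftrightarrow> y \<in> {-a - \<delta>..b + \<delta>}"
      using assms by (fastforce simp: Omega_def Omega_I_def)
  qed
  then show ?thesis by simp
qed

lemma b_n_eq_norm_S_sq:
  assumes "\<And>s. s \<ge> 0 \<Longrightarrow> k s \<ge> 0"
  shows "b_n a b \<delta> k u u = (norm_S a b \<delta> k u)\<^sup>2"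
proof -
  \<comment> \<open>\<open>norm_S\<close> integrates over the two variables in the opposite order.
    As the integrand is symmetric, renaming the bound variables matches the two double integrals
    without Fubini.\<close>
  have "nonlocal_integrand k u u x y = k \<bar>x - y\<bar> * (u x - u y)\<^sup>2" for x y
    by (simp add: nonlocal_integrand_def power2_eq_square abs_minus_commute algebra_simps)
  then show ?thesis
    unfolding b_n_def norm_S_def set_lebesgue_integral_def
    by (subst real_sqrt_pow2) (auto intro!: Bochner_Integration.integral_nonneg mult_nonneg_nonneg assms)
qed

lemma qnl_dominates_nonlocal:
  assumes k: "\<And>s. s \<ge> 0 \<Longrightarrow> k s \<ge> 0" "antimono_on {0<..} k" and M: "M > 0"
    and u: "u \<in> borel_measurable lebesgue" and fin: "finite_qnl_energy k M u"
  shows "integrable lebesgue (\<lambda>p. nonlocal_integrand k u u (fst p) (snd p))"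
    and "(LINT p|lebesgue. nonlocal_integrand k u u (fst p) (snd p)) \<le> b_qnl k M u u"
proof -
  define F where "F p = nonlocal_integrand k u u (fst p) (snd p)" for p
  \<comment> \<open>The two regions partition the plane, so \<open>G\<close> glues the two
    integrands of \<open>b_qnl\<close> into one function. Finite energy makes \<open>G\<close>
    integrable, and as a majorant of \<open>F\<close> it passes integrability on to
    \<open>F\<close>.\<close>
  define G where "G p = indicator nonlocal_region p *\<^sub>R F p +
    indicator local_region p *\<^sub>R reconstructed_integrand k M u u (fst p) (snd p)" for p
  have G: "integrable lebesgue G" "(LINT p|lebesgue. G p) = b_qnl k M u u"
    using fin by (simp_all add: G_def[abs_def] F_def b_qnl_def finite_qnl_energy_def
        set_integrable_def set_lebesgue_integral_def)
  have "F p \<ge> 0" for p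
    using k(1) by (simp add: F_def nonlocal_integrand_def mult.assoc)
  moreover have FG: "F p \<le> G p" for p
    using nonlocal_le_reconstructed_integrand[of k "snd p" "fst p" M u] k(1) M
    by (cases p) (auto simp: F_def G_def nonlocal_region_def local_region_def indicator_def)
  ultimately have "AE p in lebesgue. norm (F p) \<le> norm (G p)"
    by (intro AE_I2) (smt (verit) real_norm_def)
  moreover have "F \<in> borel_measurable lebesgue"
    unfolding F_def by (rule nonlocal_integrand_measurable[OF k(2) u])
  ultimately have "integrable lebesgue F"
    using G(1) by (blast intro: Bochner_Integration.integrable_bound)
  then show "integrable lebesgue (\<lambda>p. nonlocal_integrand k u u (fst p) (snd p))"
    and "(LINT p|lebesgue. nonlocal_integrand k u u (fst p) (snd p)) \<le> b_qnl k M u u"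
    using integral_mono[of lebesgue F G] G FG by (simp_all add: F_def[abs_def])
qed

text \<open>The integrability conjunct guards against the default value 0 that the Bochner integral
  gives to non-integrable functions.\<close>

theorem proposition3p2:
  fixes a b \<delta>\<^sub>1 \<delta>\<^sub>2 :: real and M :: nat and \<gamma> u :: "real \<Rightarrow> real"
  assumes "a > 0" and "b > 0" and "\<delta>\<^sub>1 > 0" and "\<delta>\<^sub>2 > 0"
    and "M > 0" and "\<delta>\<^sub>1 = real M * \<delta>\<^sub>2"
    and "set_borel_measurable lebesgue {0..} \<gamma>"
    and "\<And>s. s \<ge> 0 \<Longrightarrow> \<gamma> s \<ge> 0"
    and "antimono_on {0<..} \<gamma>"
    and "\<And>s. s \<ge> 1 \<Longrightarrow> \<gamma> s = 0"
    and "set_integrable lebesgue {0..1} (\<lambda>s. s\<^sup>2 * \<gamma> s)"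
    and "u \<in> S_qnl a b \<delta>\<^sub>1 (scaled_kernel \<gamma> \<delta>\<^sub>1) M"
  shows "set_integrable lebesgue
           ((Omega a b \<union> Omega_I a b \<delta>\<^sub>1) \<times> (Omega a b \<union> Omega_I a b \<delta>\<^sub>1))
           (\<lambda>p. nonlocal_integrand (scaled_kernel \<gamma> \<delta>\<^sub>1) u u (fst p) (snd p))
       \<and> b_qnl (scaled_kernel \<gamma> \<delta>\<^sub>1) M u u \<ge> b_n a b \<delta>\<^sub>1 (scaled_kernel \<gamma> \<delta>\<^sub>1) u u
       \<and> b_n a b \<delta>\<^sub>1 (scaled_kernel \<gamma> \<delta>\<^sub>1) u u = (norm_S a b \<delta>\<^sub>1 (scaled_kernel \<gamma> \<delta>\<^sub>1) u)\<^sup>2"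
proof -
  define k where "k = scaled_kernel \<gamma> \<delta>\<^sub>1"
  define D where "D = Omega a b \<union> Omega_I a b \<delta>\<^sub>1"
  define F where "F p = nonlocal_integrand k u u (fst p) (snd p)" for p
  have k_nonneg: "k s \<ge> 0" if "s \<ge> 0" for s
    using that assms(3,8) by (simp add: k_def scaled_kernel_def)
  have k_antimono: "antimono_on {0<..} k"
    using assms(3,9)
    by (auto simp: k_def scaled_kernel_def monotone_on_def divide_right_mono)
  have u: "set_borel_measurable lebesgue D u" "finite_qnl_energy k M u" "\<And>x. x \<notin> D \<Longrightarrow> u x = 0"
    using assms(12) by (auto simp: S_qnl_def square_integrable_on_def D_def k_def)
  \<comment> \<open>Since \<open>u\<close> is extended by zero, measurability on \<open>D\<close> is
    measurability on the whole line.\<close>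
  have "(\<lambda>x. indicator D x *\<^sub>R u x) = u"
    using u(3) by (auto simp: fun_eq_iff indicator_def)
  then have u_meas: "u \<in> borel_measurable lebesgue"
    using u(1) by (simp add: set_borel_measurable_def)
  have F: "integrable lebesgue F" "(LINT p|lebesgue. F p) \<le> b_qnl k M u u"
    using qnl_dominates_nonlocal[OF k_nonneg k_antimono assms(5) u_meas u(2)]
    by (simp_all add: F_def[abs_def])
  have "D \<in> sets borel"
    unfolding D_def using assms(1-3) by (intro Omega_Un_Omega_I_borel) auto
  then have "D \<times> D \<in> sets lebesgue"
    by (intro sets_completionI_sets) (simp add: borel_Times)
  then have F_DD: "integrable lebesgue (\<lambda>p. indicator (D \<times> D) p *\<^sub>R F p)"
    using F(1) by (rule integrable_mult_indicator)
  have "b_n a b \<delta>\<^sub>1 k u u = (LINT x|lebesgue. LINT y|lebesgue. indicator (D \<times> D) (x, y) *\<^sub>R F (x, y))"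
    by (simp add: b_n_def D_def set_lebesgue_integral_def F_def indicator_times mult.assoc)
  also have "\<dots> = (LINT p|lebesgue. indicator (D \<times> D) p *\<^sub>R F p)"
    by (rule integral_lebesgue_prod[OF F_DD])
  \<comment> \<open>\<open>F\<close> is nonnegative, so passing from \<open>D \<times> D\<close> to
    the whole plane cannot lower the integral.\<close>
  also have "\<dots> \<le> (LINT p|lebesgue. F p)"
    using F_DD F(1)
    by (rule integral_mono)
      (auto simp: F_def nonlocal_integrand_def mult.assoc indicator_def k_nonneg)
  finally have "b_n a b \<delta>\<^sub>1 k u u \<le> b_qnl k M u u"
    using F(2) by simp
  moreover have "set_integrable lebesgue (D \<times> D) F"
    using F_DD by (simp add: set_integrable_def)
  ultimately show ?thesis
    using b_n_eq_norm_S_sq[OF k_nonneg] by (simp add: k_def D_def F_def[abs_def])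
qed

end
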